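(* Let $G$ be a connected graph of order $n\geq 2$ with minimum degree $\delta$, and let $D_t(G,x)$ be its total domination polynomial. Then: (i) if all roots of $D_t(G,x)$ are real, then $\delta=1$ or $\delta=2$; (ii) the polynomial $D_t(G,x)$ has at least $\delta-2$ non-real roots, counted with multiplicity.
   Context: All graphs are finite and simple. The order of a graph is its number of vertices. A set $D\subseteq V$ is a total dominating set of a graph $G=(V,E)$ if every vertex of $V$ (including those in $D$) is adjacent to some vertex of $D$. Let $d_t(G,i)$ be the number of total dominating sets of $G$ of cardinality $i$. The total domination polynomial of a graph $G$ of order $n$ is $D_t(G,x)=\sum_{i=1}^{n} d_t(G,i)x^i$. Roots are taken in $\mathbb{C}$. *)

theory Defs
  imports
    Complex_Main
    "HOL-Computational_Algebra.Fundamental_Theorem_Algebra"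
    "Graph_Theory.Graph_Theory"
begin

text \<open>
  Finite simple graphs are the symmetric, loop-free, finite digraphs without parallel arcs
  of the locale \<^locale>\<open>graph\<close>: each edge is a pair of opposite arcs. Hence the degree
  of a vertex is its out-degree, which counts each incident edge once.
\<close>

definition min_degree :: "('a, 'b) pre_digraph \<Rightarrow> nat" where
  "min_degree G = Min (out_degree G ` verts G)"

definition total_dominating :: "('a, 'b) pre_digraph \<Rightarrow> 'a set \<Rightarrow> bool" where
  "total_dominating G D \<longleftrightarrow>
     D \<subseteq> verts G \<and> (\<forall>v \<in> verts G. \<exists>u \<in> D. v \<rightarrow>\<^bsub>G\<^esub> u)"

definition num_total_dominating :: "('a, 'b) pre_digraph \<Rightarrow> nat \<Rightarrow> nat" where
  "num_total_dominating G i = card {D. total_dominating G D \<and> card D = i}"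

definition total_domination_poly :: "('a, 'b) pre_digraph \<Rightarrow> complex poly" where
  "total_domination_poly G =
     (\<Sum>i = 1..card (verts G). monom (of_nat (num_total_dominating G i)) i)"

text \<open>
  The number of non-real roots, counted with multiplicity. It is meaningful only for
  \<^term>\<open>p \<noteq> 0\<close>; a total domination polynomial of a graph without isolated vertices
  is monic, since the whole vertex set is then total dominating.
\<close>

definition num_nonreal_roots :: "complex poly \<Rightarrow> nat" where
  "num_nonreal_roots p = (\<Sum>z | poly p z = 0 \<and> z \<notin> \<real>. order z p)"

end

theory Submission
  imports Defs
begin

text \<open>
  Let \<open>G\<close> have order \<open>n\<close> and minimum degree \<open>\<delta>\<close>. A set with more than \<open>n - \<delta>\<close> vertices
  leaves out fewer than \<open>\<delta>\<close> vertices, too few to contain the neighbourhood of any vertex, so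
  it is total dominating. Hence the coefficients of \<open>x\<^sup>i\<close> with \<open>i > n - \<delta>\<close> are the
  binomial coefficients, and the total domination polynomial is \<open>(1 + x)\<^sup>n + r\<close> with
  \<open>deg r \<le> n - \<delta>\<close> (\<open>real_total_domination_poly_decomp\<close>). Since the empty set is not
  counted, \<open>r\<close> has constant coefficient \<open>-1\<close> and is not zero.

  The rest concerns real polynomials only: \<open>c (x - a)\<^sup>n + r\<close> with \<open>r \<noteq> 0\<close> and \<open>deg r < n\<close>
  has at most \<open>deg r + 2\<close> real roots, counted with multiplicity
  (\<open>size_proots_linear_power_plus\<close>). By Rolle's theorem, differentiation destroys at most one
  real root (\<open>size_proots_le_pderiv\<close>). After \<open>deg r\<close> derivatives a polynomial of the form
  \<open>c' (x - a)\<^sup>k + d\<close> with \<open>d \<noteq> 0\<close> remains, whose real roots are simple and number at most two.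

  So at most \<open>n - \<delta> + 2\<close> of the \<open>n\<close> roots are real, and at least \<open>\<delta> - 2\<close> are not. If
  all roots are real, this forces \<open>\<delta> \<le> 2\<close>, while \<open>\<delta> \<ge> 1\<close> because a connected
  graph with at least two vertices has no isolated vertex.
\<close>

section \<open>Real roots and the derivative\<close>

lemma size_proots_eq_sum_order:
  fixes p :: "'a::idom poly"
  assumes "p \<noteq> 0"
  shows "size (proots p) = (\<Sum>z | poly p z = 0. order z p)"
  using assms by (simp add: size_multiset_overloaded_eq)

text \<open>
  Rolle's theorem applied between consecutive elements of \<open>S\<close>. The points of \<open>T\<close> are kept
  outside \<open>S\<close>, so that they can be counted in addition to the multiple roots of \<open>p\<close>, which are
  themselves roots of the derivative. The clause that each point of \<open>T\<close> lies below some element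
  of \<open>S\<close> carries the induction, which extends \<open>S\<close> by a new maximum: it keeps the next Rolle
  point and the new maximum outside the old \<open>T\<close>.
\<close>

lemma roots_pderiv_between_roots:
  fixes p :: "real poly"
  assumes "finite S" "S \<noteq> {}" "\<And>a. a \<in> S \<Longrightarrow> poly p a = 0"
  shows "\<exists>T. finite T \<and> card S = card T + 1 \<and> T \<inter> S = {} \<and>
           (\<forall>t\<in>T. poly (pderiv p) t = 0 \<and> (\<exists>s\<in>S. t < s))"
  using assms
proof (induction S rule: finite_linorder_max_induct)
  case empty
  then show ?case by simp
next
  case (insert b S)
  show ?case
  proof (cases "S = {}")
    case True
    then show ?thesis by (intro exI[of _ "{}"]) simp
  next
    case False
    then obtain T where T: "finite T" "card S = card T + 1" "T \<inter> S = {}"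
      "\<forall>t\<in>T. poly (pderiv p) t = 0 \<and> (\<exists>s\<in>S. t < s)"
      using insert by (metis insertCI)
    define m where "m = Max S"
    have m: "m \<in> S" "\<And>s. s \<in> S \<Longrightarrow> s \<le> m"
      using insert.hyps False by (auto simp: m_def)
    have "m < b" using insert.hyps m by blast
    then obtain x where x: "m < x" "x < b" "poly p b - poly p m = (b - m) * poly (pderiv p) x"
      using poly_MVT by blast
    have "poly (pderiv p) x = 0"
      using x insert.prems m \<open>m < b\<close> by simp
    moreover have "x \<notin> S" using m x by force
    moreover have "x \<notin> T" using T(4) m x by force
    moreover have "b \<notin> T" using T(4) insert.hyps by force
    moreover have "b \<notin> S" using insert.hyps by blast
    ultimately show ?thesis
      using T x insert.hyps(1) by (intro exI[of _ "insert x T"]) auto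
  qed
qed

text \<open>
  Each of the \<open>k\<close> distinct real roots of \<open>p\<close> loses one unit of multiplicity in the derivative,
  and the \<open>k - 1\<close> gaps between them each give back at least one new root.
\<close>

lemma size_proots_le_pderiv:
  fixes p :: "real poly"
  assumes "pderiv p \<noteq> 0"
  shows "size (proots p) \<le> size (proots (pderiv p)) + 1"
proof -
  have p0: "p \<noteq> 0" using assms by auto
  define S where "S = {a. poly p a = 0}"
  define R where "R = {a. poly (pderiv p) a = 0}"
  have finS: "finite S" and finR: "finite R"
    using p0 assms by (auto simp: S_def R_def poly_roots_finite)
  have sizep: "size (proots p) = (\<Sum>a\<in>S. order a p)"
    unfolding S_def by (rule size_proots_eq_sum_order[OF p0])
  have sizep': "size (proots (pderiv p)) = (\<Sum>a\<in>R. order a (pderiv p))"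
    unfolding R_def by (rule size_proots_eq_sum_order[OF assms])
  show ?thesis
  proof (cases "S = {}")
    case True
    then show ?thesis using sizep by simp
  next
    case False
    obtain T where T: "finite T" "card S = card T + 1" "T \<inter> S = {}"
      "\<forall>t\<in>T. poly (pderiv p) t = 0 \<and> (\<exists>s\<in>S. t < s)"
      using roots_pderiv_between_roots[OF finS False, of p] by (auto simp: S_def)
    have ord: "order a p = order a (pderiv p) + 1" if "a \<in> S" for a
      using order_pderiv[OF p0, of a] that p0 by (simp add: S_def order_root)
    have "size (proots p) = (\<Sum>a\<in>S. order a (pderiv p)) + card T + 1"
      using T(2) by (simp add: sizep ord sum_Suc)
    also have "card T \<le> (\<Sum>a\<in>T. order a (pderiv p))"
    proof -
      have "(\<Sum>a\<in>T. 1) \<le> (\<Sum>a\<in>T. order a (pderiv p))"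
        using T(4) assms by (intro sum_mono) (auto simp: order_root Suc_le_eq)
      then show ?thesis by simp
    qed
    also have "(\<Sum>a\<in>S. order a (pderiv p)) + (\<Sum>a\<in>T. order a (pderiv p)) =
        (\<Sum>a\<in>S \<union> T. order a (pderiv p))"
      using T finS by (subst sum.union_disjoint) auto
    also have "\<dots> = (\<Sum>a\<in>(S \<union> T) \<inter> R. order a (pderiv p))"
      using T finS by (intro sum.mono_neutral_right) (auto simp: R_def order_0I)
    also have "\<dots> \<le> (\<Sum>a\<in>R. order a (pderiv p))"
      using finR by (intro sum_mono2) auto
    finally show ?thesis by (simp add: sizep')
  qed
qed

section \<open>Real roots of a low-degree perturbation of a power\<close>

text \<open>
  Over the reals, the equation \<open>u\<^sup>n = e\<close> determines the absolute value of \<open>u\<close>.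
\<close>

lemma card_roots_power_plus_const:
  fixes a c d :: real
  assumes "c \<noteq> 0" "n > 0"
  shows "card {x. c * (x - a) ^ n + d = 0} \<le> 2"
proof (cases "{x. c * (x - a) ^ n + d = 0} = {}")
  case False
  then obtain y where y: "c * (y - a) ^ n + d = 0" by auto
  have "x \<in> {y, 2 * a - y}" if "c * (x - a) ^ n + d = 0" for x
  proof -
    have "(x - a) ^ n = (y - a) ^ n"
      using y that assms by (metis add_right_cancel mult_left_cancel)
    then have "\<bar>x - a\<bar> ^ n = \<bar>y - a\<bar> ^ n" by (metis power_abs)
    then have "\<bar>x - a\<bar> = \<bar>y - a\<bar>"
      using \<open>n > 0\<close> by (simp add: power_eq_iff_eq_base)
    then show ?thesis by auto
  qed
  then have "card {x. c * (x - a) ^ n + d = 0} \<le> card {y, 2 * a - y}"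
    by (intro card_mono) auto
  also have "\<dots> \<le> 2" by (rule order_trans[OF card_insert_le_m1]) auto
  finally show ?thesis .
qed simp

lemma pderiv_linear_power:
  fixes a c :: real
  shows "pderiv (smult c ([:-a, 1:] ^ n)) = smult (c * of_nat n) ([:-a, 1:] ^ (n - 1))"
  by (simp add: pderiv_smult pderiv_power pderiv_pCons)

lemma degree_linear_power_plus:
  fixes a c :: real
  assumes "c \<noteq> 0" "degree r < n"
  shows "degree (smult c ([:-a, 1:] ^ n) + r) = n"
  using assms by (simp add: degree_add_eq_left degree_linear_power)

text \<open>
  Induction on the degree of \<open>r\<close>: differentiation turns \<open>c (x - a)\<^sup>n + r\<close> into a polynomial of
  the same shape with \<open>deg r\<close> and \<open>n\<close> both lowered by one, at the cost of at most one real root.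
\<close>

lemma size_proots_linear_power_plus:
  fixes r :: "real poly"
  assumes "c \<noteq> 0" "r \<noteq> 0" "degree r < n"
  shows "size (proots (smult c ([:-a, 1:] ^ n) + r)) \<le> degree r + 2"
  using assms
proof (induction "degree r" arbitrary: r c n)
  case 0
  define p where "p = smult c ([:-a, 1:] ^ n) + r"
  obtain d where r: "r = [:d:]" using 0(1) by (metis degree_eq_zeroE)
  have d: "d \<noteq> 0" using 0 r by simp
  have p0: "p \<noteq> 0"
    using degree_linear_power_plus[OF \<open>c \<noteq> 0\<close> \<open>degree r < n\<close>, of a] 0 by (auto simp: p_def)
  have poly: "poly p x = c * (x - a) ^ n + d" for x
    by (simp add: p_def r algebra_simps)
  have p': "pderiv p = smult (c * of_nat n) ([:-a, 1:] ^ (n - 1))"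
    by (simp add: p_def r pderiv_add pderiv_linear_power pderiv_pCons)
  \<comment> \<open>The derivative can vanish only at \<open>a\<close>, where \<open>p\<close> takes the value \<open>d \<noteq> 0\<close>.\<close>
  have "order x p = 1" if "poly p x = 0" for x
  proof -
    have "x \<noteq> a" using that poly d 0 by (auto simp: power_0_left)
    then have "poly (pderiv p) x \<noteq> 0" using 0 by (simp add: p')
    then have "order x (pderiv p) = 0" by (rule order_0I)
    then show ?thesis using order_pderiv[OF p0, of x] that p0 by (simp add: order_root)
  qed
  then have "size (proots p) = card {x. poly p x = 0}"
    by (simp add: size_proots_eq_sum_order[OF p0])
  also have "\<dots> \<le> 2"
    unfolding poly using card_roots_power_plus_const 0 by auto
  finally show ?case by (simp add: p_def)
next
  case (Suc m)
  define p where "p = smult c ([:-a, 1:] ^ n) + r"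
  have p': "pderiv p = smult (c * of_nat n) ([:-a, 1:] ^ (n - 1)) + pderiv r"
    by (simp add: p_def pderiv_add pderiv_linear_power)
  have r': "pderiv r \<noteq> 0" "degree (pderiv r) = m"
    using Suc.hyps(2) by (auto simp: pderiv_eq_0_iff degree_pderiv)
  have c': "c * of_nat n \<noteq> 0" and n': "degree (pderiv r) < n - 1"
    using Suc.prems Suc.hyps(2) r' by auto
  have "degree (pderiv p) = n - 1"
    unfolding p' by (rule degree_linear_power_plus[OF c' n'])
  then have "pderiv p \<noteq> 0" using n' by auto
  then have "size (proots p) \<le> size (proots (pderiv p)) + 1"
    by (rule size_proots_le_pderiv)
  also have "size (proots (pderiv p)) \<le> m + 2"
    unfolding p' using Suc.hyps(1)[OF _ c' r'(1) n'] r' by simp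
  finally show ?case using Suc.hyps(2) by (simp add: p_def)
qed

section \<open>Non-real roots of real polynomials\<close>

lemma poly_map_poly_of_real:
  "poly (map_poly of_real p) (of_real x :: complex) = of_real (poly p x)"
  by (induction p) (auto simp: map_poly_pCons)

lemma map_poly_of_real_mult:
  "map_poly of_real (p * q) = (map_poly of_real p * map_poly of_real q :: complex poly)"
  by (rule poly_eqI) (simp add: coeff_map_poly coeff_mult)

lemma map_poly_of_real_power:
  "map_poly of_real (p ^ n) = (map_poly of_real p ^ n :: complex poly)"
  by (induction n) (simp_all add: map_poly_of_real_mult)

lemma order_map_poly_of_real:
  fixes p :: "real poly"
  assumes "p \<noteq> 0"
  shows "order (of_real x :: complex) (map_poly of_real p) = order x p"
proof -
  obtain q where q: "p = [:-x, 1:] ^ order x p * q" "\<not> [:-x, 1:] dvd q"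
    using order_decomp[OF assms, of x] by blast
  have "poly q x \<noteq> 0" using q(2) by (simp add: poly_eq_0_iff_dvd)
  then have q': "poly (map_poly of_real q) (of_real x :: complex) \<noteq> 0"
    by (simp add: poly_map_poly_of_real)
  then have "map_poly of_real q \<noteq> (0 :: complex poly)" by auto
  moreover have eq: "map_poly of_real p =
      ([:-of_real x, 1:] ^ order x p * map_poly of_real q :: complex poly)"
    by (subst q(1)) (simp add: map_poly_of_real_mult map_poly_of_real_power map_poly_pCons)
  ultimately show ?thesis
    unfolding eq by (subst order_mult) (auto simp: order_power_n_n order_0I[OF q'])
qed

text \<open>
  By the fundamental theorem of algebra, it is enough to bound the real roots from above; and
  these can be counted in the real polynomial, where Rolle's theorem is available.
\<close>

lemma num_nonreal_roots_map_poly_of_real: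
  fixes p :: "real poly"
  assumes "p \<noteq> 0"
  shows "num_nonreal_roots (map_poly of_real p) + size (proots p) = degree p"
proof -
  define P :: "complex poly" where "P = map_poly of_real p"
  have deg: "degree P = degree p" unfolding P_def by (simp add: degree_map_poly)
  have P0: "P \<noteq> 0" using assms by (auto simp: P_def map_poly_eq_0_iff)
  define A where "A = {z. poly P z = 0 \<and> z \<notin> \<real>}"
  have fin: "finite {z. poly P z = 0}" using P0 by (simp add: poly_roots_finite)
  have real: "{z. poly P z = 0 \<and> z \<in> \<real>} = complex_of_real ` {x. poly p x = 0}"
    by (auto simp: P_def poly_map_poly_of_real elim!: Reals_cases)
  have "degree P = (\<Sum>z | poly P z = 0. order z P)"
    using size_proots_complex[of P] size_proots_eq_sum_order[OF P0] by simp
  also have "{z. poly P z = 0} = A \<union> {z. poly P z = 0 \<and> z \<in> \<real>}"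
    by (auto simp: A_def)
  also have "(\<Sum>z\<in>\<dots>. order z P) =
      (\<Sum>z\<in>A. order z P) + (\<Sum>z | poly P z = 0 \<and> z \<in> \<real>. order z P)"
    by (rule sum.union_disjoint) (auto simp: A_def intro: finite_subset[OF _ fin])
  also have "(\<Sum>z | poly P z = 0 \<and> z \<in> \<real>. order z P) = (\<Sum>x | poly p x = 0. order x p)"
    unfolding real
    by (subst sum.reindex) (auto simp: inj_on_def P_def order_map_poly_of_real[OF assms])
  also have "\<dots> = size (proots p)"
    by (simp add: size_proots_eq_sum_order[OF assms])
  finally show ?thesis
    unfolding deg num_nonreal_roots_def by (simp add: A_def P_def)
qed

lemma ex_nonreal_root:
  assumes "num_nonreal_roots p > 0"
  shows "\<exists>z. poly p z = 0 \<and> z \<notin> \<real>"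
  using assms unfolding num_nonreal_roots_def by (metis (mono_tags, lifting) mem_Collect_eq less_irrefl sum.neutral)

section \<open>Total dominating sets\<close>

context digraph
begin

text \<open>
  Without parallel arcs, counting arcs that leave a vertex is the same as counting neighbours.
\<close>

lemma card_out_neighbours: "card {u. v \<rightarrow>\<^bsub>G\<^esub> u} = out_degree G v"
proof -
  have "{u. v \<rightarrow>\<^bsub>G\<^esub> u} = head G ` out_arcs G v"
    by (auto simp: arcs_ends_conv)
  moreover have "inj_on (head G) (out_arcs G v)"
    by (auto intro!: inj_onI no_multi_arcs simp: arc_to_ends_def)
  ultimately show ?thesis by (simp add: card_image out_degree_def)
qed

lemma out_neighbours_subset: "{u. v \<rightarrow>\<^bsub>G\<^esub> u} \<subseteq> verts G"
  using adj_in_verts by auto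

lemma min_degree_le_out_degree: "v \<in> verts G \<Longrightarrow> min_degree G \<le> out_degree G v"
  unfolding min_degree_def by (rule Min_le) auto

lemma min_degree_le_order:
  assumes "verts G \<noteq> {}"
  shows "min_degree G \<le> card (verts G)"
proof -
  obtain v where "v \<in> verts G" using assms by auto
  then have "min_degree G \<le> card {u. v \<rightarrow>\<^bsub>G\<^esub> u}"
    using min_degree_le_out_degree card_out_neighbours by simp
  also have "\<dots> \<le> card (verts G)"
    by (rule card_mono[OF finite_verts out_neighbours_subset])
  finally show ?thesis .
qed

text \<open>
  The complement of \<open>D\<close> has fewer than \<open>min_degree G\<close> elements, so no neighbourhood fits in it.
\<close>

lemma total_dominating_large:
  assumes "D \<subseteq> verts G" "card D + min_degree G > card (verts G)"
  shows "total_dominating G D"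
  unfolding total_dominating_def
proof (intro conjI ballI assms(1))
  fix v assume v: "v \<in> verts G"
  let ?N = "{u. v \<rightarrow>\<^bsub>G\<^esub> u}"
  show "\<exists>u\<in>D. v \<rightarrow>\<^bsub>G\<^esub> u"
  proof (rule ccontr)
    assume "\<not> ?thesis"
    then have "D \<inter> ?N = {}" by auto
    then have "card D + card ?N = card (D \<union> ?N)"
      using finite_subset[OF assms(1)] finite_subset[OF out_neighbours_subset]
      by (intro card_Un_disjoint[symmetric]) simp_all
    also have "\<dots> \<le> card (verts G)"
      using assms(1) out_neighbours_subset by (intro card_mono) auto
    finally show False
      using assms(2) min_degree_le_out_degree[OF v] card_out_neighbours[of v] by simp
  qed
qed

lemma num_total_dominating_large:
  assumes "i + min_degree G > card (verts G)"
  shows "num_total_dominating G i = card (verts G) choose i"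
proof -
  have "{D. total_dominating G D \<and> card D = i} = {D. D \<subseteq> verts G \<and> card D = i}"
    using total_dominating_large assms by (auto simp: total_dominating_def)
  then show ?thesis by (simp add: num_total_dominating_def n_subsets)
qed

end

text \<open>
  A path from a vertex to a different one has a first arc.
\<close>

lemma (in graph) min_degree_pos:
  assumes "connected G" "card (verts G) \<ge> 2"
  shows "min_degree G > 0"
proof -
  have sc: "strongly_connected G"
    using symmetric_connected_imp_strongly_connected[OF sym_arcs assms(1)] .
  have "out_degree G v > 0" if v: "v \<in> verts G" for v
  proof -
    have "\<not> verts G \<subseteq> {v}"
      using assms(2) card_mono[of "{v}" "verts G"] by auto
    then obtain w where w: "w \<in> verts G" "w \<noteq> v" by auto
    then have "v \<rightarrow>\<^sup>*\<^bsub>G\<^esub> w" using sc v by auto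
    then obtain u where "v \<rightarrow>\<^bsub>G\<^esub> u"
      using w by (cases rule: converse_reachable_cases) auto
    then have "{u. v \<rightarrow>\<^bsub>G\<^esub> u} \<noteq> {}" by auto
    moreover have "finite {u. v \<rightarrow>\<^bsub>G\<^esub> u}"
      using finite_subset[OF out_neighbours_subset] by simp
    ultimately show ?thesis
      unfolding card_out_neighbours[symmetric] by (simp add: card_gt_0_iff)
  qed
  moreover have "verts G \<noteq> {}" using assms(2) by auto
  ultimately show ?thesis unfolding min_degree_def by (subst Min_gr_iff) auto
qed

section \<open>The total domination polynomial\<close>

text \<open>
  Rolle's theorem needs real coefficients, while the roots are taken in the complex numbers.
\<close>

definition real_total_domination_poly :: "('a, 'b) pre_digraph \<Rightarrow> real poly" where
  "real_total_domination_poly G =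
     (\<Sum>i = 1..card (verts G). monom (of_nat (num_total_dominating G i)) i)"

lemma coeff_real_total_domination_poly:
  "coeff (real_total_domination_poly G) i =
     (if 1 \<le> i \<and> i \<le> card (verts G) then of_nat (num_total_dominating G i) else 0)"
  by (simp add: real_total_domination_poly_def coeff_sum)

lemma map_poly_real_total_domination_poly:
  "map_poly of_real (real_total_domination_poly G) = total_domination_poly G"
  by (rule poly_eqI)
     (simp add: coeff_map_poly coeff_real_total_domination_poly total_domination_poly_def coeff_sum)

lemma (in digraph) real_total_domination_poly_decomp:
  assumes "verts G \<noteq> {}"
  obtains r where "real_total_domination_poly G = [:1, 1:] ^ card (verts G) + r"
    and "r \<noteq> 0" and "degree r \<le> card (verts G) - min_degree G"
proof
  let ?n = "card (verts G)"
  define r where "r = real_total_domination_poly G - [:1, 1:] ^ ?n"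
  show "real_total_domination_poly G = [:1, 1:] ^ ?n + r"
    by (simp add: r_def)
  have "coeff r 0 = -1"
    by (simp add: r_def coeff_real_total_domination_poly coeff_linear_poly_power)
  then show "r \<noteq> 0" by auto
  show "degree r \<le> ?n - min_degree G"
  proof (rule degree_le, intro allI impI)
    fix i assume i: "?n - min_degree G < i"
    then have "num_total_dominating G i = ?n choose i"
      by (intro num_total_dominating_large) auto
    then show "coeff r i = 0"
      using i by (cases "i \<le> ?n")
        (auto simp: r_def coeff_real_total_domination_poly coeff_linear_poly_power
           binomial_eq_0 coeff_eq_0 degree_linear_power)
  qed
qed

lemma (in digraph) num_nonreal_roots_total_domination_poly:
  assumes "verts G \<noteq> {}" "min_degree G > 0"
  shows "min_degree G \<le> num_nonreal_roots (total_domination_poly G) + 2"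
proof -
  let ?n = "card (verts G)" and ?p = "real_total_domination_poly G"
  obtain r where r: "?p = [:1, 1:] ^ ?n + r" "r \<noteq> 0" "degree r \<le> ?n - min_degree G"
    using real_total_domination_poly_decomp[OF assms(1)] .
  have le: "min_degree G \<le> ?n" by (rule min_degree_le_order[OF assms(1)])
  have p: "?p = smult 1 ([:-(-1), 1:] ^ ?n) + r" by (simp add: r(1))
  have lt: "degree r < ?n" using r(3) assms(2) le by linarith
  have deg: "degree ?p = ?n"
    unfolding p by (rule degree_linear_power_plus[OF _ lt]) simp
  have "size (proots ?p) \<le> degree r + 2"
    unfolding p by (rule size_proots_linear_power_plus[OF _ r(2) lt]) simp
  moreover have "?p \<noteq> 0" using deg lt by auto
  then have "num_nonreal_roots (total_domination_poly G) + size (proots ?p) = ?n"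
    using num_nonreal_roots_map_poly_of_real[of ?p]
    by (simp add: map_poly_real_total_domination_poly deg)
  ultimately show ?thesis using r(3) le by linarith
qed

theorem theorem2p1:
  fixes G :: "('a, 'b) pre_digraph"
  assumes "Digraph.graph G"
    and "Digraph_Component.connected G"
    and "card (verts G) \<ge> 2"
  shows "((\<forall>z. poly (total_domination_poly G) z = 0 \<longrightarrow> z \<in> \<real>) \<longrightarrow>
           min_degree G = 1 \<or> min_degree G = 2) \<and>
         int (num_nonreal_roots (total_domination_poly G)) \<ge> int (min_degree G) - 2"
proof -
  interpret graph G by fact
  have pos: "min_degree G > 0" by (rule min_degree_pos) fact+
  have "verts G \<noteq> {}" using assms(3) by auto
  then have main: "min_degree G \<le> num_nonreal_roots (total_domination_poly G) + 2"
    using pos by (rule num_nonreal_roots_total_domination_poly)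
  have "min_degree G = 1 \<or> min_degree G = 2"
    if "\<forall>z. poly (total_domination_poly G) z = 0 \<longrightarrow> z \<in> \<real>"
  proof -
    have "num_nonreal_roots (total_domination_poly G) = 0"
      using ex_nonreal_root that by blast
    then show ?thesis using main pos by auto
  qed
  then show ?thesis using main by auto
qed

end
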